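(* Let $G$ be a digraph with vertex set $\{1,2,\dots,n\}$, let $H_1,\dots,H_n$ be digraphs with $m_i=|V(H_i)|$ for $1\le i\le n$, and let $\overrightarrow{G}=G[H_1,H_2,\dots,H_n]$ be their generalized join digraph with respect to $G$. Then the characteristic polynomial of the Laplacian matrix $L_{\overrightarrow{G}}$ can be expressed by $$f(L_{\overrightarrow{G}},\lambda)=f(B(L_{\overrightarrow{G}}),\lambda)\prod_{i=1}^{n}\prod_{k=1}^{m_i-1}\left(\lambda-\mu_k(H_i)-\sum_{j:\,(i,j)\in E(G)}m_j\right),$$ where $B(L_{\overrightarrow{G}})$ is the $n\times n$ matrix $$B(L_{\overrightarrow{G}})=\begin{pmatrix}\sum_{(1,j)\in E(G)}m_j & -a_{12} & \cdots & -a_{1n}\\ -a_{21} & \sum_{(2,j)\in E(G)}m_j & \cdots & -a_{2n}\\ \vdots & \vdots & \ddots & \vdots\\ -a_{n1} & -a_{n2} & \cdots & \sum_{(n,j)\in E(G)}m_j\end{pmatrix},$$ with $a_{ij}=m_j$ if $(i,j)\in E(G)$ and $a_{ij}=0$ otherwise.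
   Context: Digraphs are finite, with nonempty vertex set, without loops or multiple edges (both $(u,v)$ and $(v,u)$ may be edges); $(u,v)$ is directed from $u$ to $v$. Generalized join digraph: $G[H_1,\dots,H_n]$ is obtained from $G$ by replacing each vertex $i$ with $H_i$: its vertex set is the disjoint union $V(H_1)\cup\dots\cup V(H_n)$, the edges inside each $H_i$ are kept, and for $i\ne j$, $u\in V(H_i)$, $v\in V(H_j)$, $(u,v)$ is an edge if and only if $(i,j)\in E(G)$. For a square matrix $A$ of order $N$, $f(A,\lambda)=\det(\lambda I_N-A)$. For an unweighted digraph $H$, the Laplacian matrix $L_H$ has $(L_H)_{uu}=$ the outdegree of $u$, $(L_H)_{uv}=-1$ if $(u,v)\in E(H)$, and $0$ otherwise. The Laplacian eigenvalues $\mu_1(H),\dots,\mu_m(H)$ ($m=|V(H)|$) are the complex eigenvalues of $L_H$ with algebraic multiplicity; since all row sums of $L_H$ are $0$, $0$ is an eigenvalue, and the numbering is such that $\mu_m(H)=0$. Empty products equal $1$. *)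

theory Defs
  imports
    "Graph_Theory.Pair_Digraph"
    "Jordan_Normal_Form.Char_Poly"
    "HOL-Library.Multiset"
begin

text \<open>
  A digraph without loops and multiple edges is a \<open>pair_digraph\<close>: finite, well-formed, loop-free,
  with edges given as a set of ordered pairs.
\<close>

definition gen_join ::
  "'i pair_pre_digraph \<Rightarrow> ('i \<Rightarrow> 'a pair_pre_digraph) \<Rightarrow> ('i \<times> 'a) pair_pre_digraph" where
  "gen_join G H = \<lparr>
     pverts = Sigma (pverts G) (\<lambda>i. pverts (H i)),
     parcs = {((i, u), (j, v)) | i u j v.
       i \<in> pverts G \<and> u \<in> pverts (H i) \<and> j \<in> pverts G \<and> v \<in> pverts (H j) \<and>
       (if i = j then (u, v) \<in> parcs (H i) else (i, j) \<in> parcs G)} \<rparr>"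

text \<open>
  The rows and columns of the Laplacian matrix are indexed by vertices, whereas library matrices
  are indexed by an initial segment of the naturals; hence the matrix is taken with respect to an
  explicit listing of the vertices.
\<close>

definition vertex_listing :: "'v pair_pre_digraph \<Rightarrow> 'v list \<Rightarrow> bool" where
  "vertex_listing H vs \<longleftrightarrow> distinct vs \<and> set vs = pverts H"

definition laplacian_entry :: "'v pair_pre_digraph \<Rightarrow> 'v \<Rightarrow> 'v \<Rightarrow> complex" where
  "laplacian_entry H u v =
     (if u = v then of_nat (out_degree (with_proj H) u)
      else if (u, v) \<in> parcs H then - 1 else 0)"

definition laplacian_mat :: "'v pair_pre_digraph \<Rightarrow> 'v list \<Rightarrow> complex mat" where
  "laplacian_mat H vs =
     mat (length vs) (length vs) (\<lambda>(r, c). laplacian_entry H (vs ! r) (vs ! c))"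

text \<open>The eigenvalues of a square matrix, counted with algebraic multiplicity.\<close>

definition eigenvalue_mset :: "complex mat \<Rightarrow> complex multiset" where
  "eigenvalue_mset A = proots (char_poly A)"

lemma set_eigenvalue_mset:
  assumes "A \<in> carrier_mat N N"
  shows "set_mset (eigenvalue_mset A) = Collect (eigenvalue A)"
proof -
  have "char_poly A \<noteq> 0"
    using degree_monic_char_poly[OF assms] by auto
  then show ?thesis
    by (auto simp: eigenvalue_mset_def eigenvalue_root_char_poly[OF assms])
qed

definition join_arc_weight :: "'i pair_pre_digraph \<Rightarrow> ('i \<Rightarrow> nat) \<Rightarrow> 'i \<Rightarrow> 'i \<Rightarrow> nat" where
  "join_arc_weight G m i j = (if (i, j) \<in> parcs G then m j else 0)"

text \<open>Library matrices are indexed from 0, while the vertices of \<open>G\<close> are \<open>1, \<dots>, n\<close>.\<close>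

definition join_B_mat :: "nat \<Rightarrow> nat pair_pre_digraph \<Rightarrow> (nat \<Rightarrow> nat) \<Rightarrow> complex mat" where
  "join_B_mat n G m = mat n n (\<lambda>(r, c).
     if r = c then of_nat (\<Sum>j | (r + 1, j) \<in> parcs G. m j)
     else - of_nat (join_arc_weight G m (r + 1) (c + 1)))"

end

theory Submission
  imports Defs
begin

text \<open>
  The partition of the vertices of the join into the sets \<open>V(H\<^sub>i)\<close> is equitable for the
  Laplacian: the row sums over each block depend only on the block of the row. Hence the
  characteristic polynomial is that of the quotient matrix, which is \<open>B\<close>, times that of the
  matrix obtained from the other vertices by subtracting from each row the row of a chosen
  representative of its block. In this second factor the off-diagonal blocks cancel, and the
  \<open>i\<close>-th diagonal block is the corresponding reduction of \<open>L\<^bsub>H\<^sub>i\<^esub>\<close> shifted by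
  \<open>\<Sum>m\<^sub>j\<close>. The same factorization for \<open>H\<^sub>i\<close> alone, with a single block and quotient matrix \<open>0\<close>,
  identifies the eigenvalues of the reduction as \<open>\<mu>\<^sub>k(H\<^sub>i)\<close> for \<open>k < m\<^sub>i\<close>.
\<close>

section \<open>Matrices and determinants indexed by lists of arbitrary labels\<close>

definition list_mat :: "('v \<Rightarrow> 'v \<Rightarrow> 'c) \<Rightarrow> 'v list \<Rightarrow> 'c mat" where
  "list_mat A xs = mat (length xs) (length xs) (\<lambda>(r, c). A (xs ! r) (xs ! c))"

lemma list_mat_carrier [simp]: "list_mat A xs \<in> carrier_mat (length xs) (length xs)"
  and dim_row_list_mat [simp]: "dim_row (list_mat A xs) = length xs"
  and dim_col_list_mat [simp]: "dim_col (list_mat A xs) = length xs"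
  by (auto simp: list_mat_def)

lemma laplacian_mat_eq_list_mat: "laplacian_mat H vs = list_mat (laplacian_entry H) vs"
  by (simp add: laplacian_mat_def list_mat_def)

lemma list_mat_cong:
  assumes "xs = ys" "\<And>u v. u \<in> set ys \<Longrightarrow> v \<in> set ys \<Longrightarrow> A u v = B u v"
  shows "list_mat A xs = list_mat B ys"
  using assms by (auto simp: list_mat_def)

lemma list_mat_map: "list_mat A (map f xs) = list_mat (\<lambda>u v. A (f u) (f v)) xs"
  by (auto simp: list_mat_def)

lemma list_mat_times:
  fixes A B :: "'v \<Rightarrow> 'v \<Rightarrow> 'c :: comm_ring_1"
  assumes "distinct xs"
  shows "list_mat A xs * list_mat B xs = list_mat (\<lambda>u v. \<Sum>w\<in>set xs. A u w * B w v) xs"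
proof (rule eq_matI)
  fix i j
  assume ij: "i < dim_row (list_mat (\<lambda>u v. \<Sum>w\<in>set xs. A u w * B w v) xs)"
    "j < dim_col (list_mat (\<lambda>u v. \<Sum>w\<in>set xs. A u w * B w v) xs)"
  have "(\<Sum>k = 0..<length xs. A (xs ! i) (xs ! k) * B (xs ! k) (xs ! j))
      = (\<Sum>w\<in>set xs. A (xs ! i) w * B w (xs ! j))"
    by (rule sum.reindex_bij_betw[OF bij_betw_nth])
       (use assms in auto)
  with ij show "(list_mat A xs * list_mat B xs) $$ (i, j)
      = list_mat (\<lambda>u v. \<Sum>w\<in>set xs. A u w * B w v) xs $$ (i, j)"
    by (simp add: list_mat_def scalar_prod_def)
qed auto

text \<open>Relisting the labels permutes rows and columns by the same permutation, so its sign
  occurs twice and squares to 1. This allows the vertices of the join to be listed with block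
  representatives first.\<close>

lemma det_list_mat_mset_cong:
  fixes A :: "'v \<Rightarrow> 'v \<Rightarrow> 'c :: comm_ring_1"
  assumes "mset xs = mset ys"
  shows "det (list_mat A xs) = det (list_mat A ys)"
proof -
  obtain p where p: "p permutes {..<length ys}" "permute_list p ys = xs"
    using assms by (rule mset_eq_permutation)
  define n where "n = length ys"
  have p': "p permutes {0..<n}"
    using p(1) by (simp add: n_def lessThan_atLeast0)
  have lt: "p i < n" if "i < n" for i
    using permutes_in_image[OF p', of i] that by auto
  have len: "length xs = n" using assms by (metis mset_eq_length n_def)
  have nth: "xs ! i = ys ! p i" if "i < n" for i
    using p that permute_list_nth[of p ys i] by (simp add: n_def)
  \<comment> \<open>\<open>A1\<close> has only its columns permuted: one row permutation leads from
    it to \<open>list_mat A xs\<close>, and the columns are handled as rows of the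
    transpose.\<close>
  define A1 where "A1 = mat n n (\<lambda>(i, j). A (ys ! i) (ys ! p j))"
  have A1: "A1 \<in> carrier_mat n n" by (simp add: A1_def)
  have "list_mat A xs = mat n n (\<lambda>(i, j). A1 $$ (p i, j))"
    by (auto simp: list_mat_def A1_def len lt nth)
  then have 1: "det (list_mat A xs) = signof p * det A1"
    using det_permute_rows[OF A1 p'] by simp
  have A1': "transpose_mat A1 = mat n n (\<lambda>(i, j). transpose_mat (list_mat A ys) $$ (p i, j))"
    by (rule eq_matI) (auto simp: list_mat_def A1_def lt n_def[symmetric])
  have "det A1 = det (transpose_mat A1)"
    using det_transpose[OF A1] by simp
  also have "\<dots> = signof p * det (transpose_mat (list_mat A ys))"
    unfolding A1' by (rule det_permute_rows[OF _ p']) (simp add: n_def)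
  also have "det (transpose_mat (list_mat A ys)) = det (list_mat A ys)"
    by (rule det_transpose) auto
  finally have "det (list_mat A xs) = (signof p * signof p) * det (list_mat A ys)"
    using 1 by simp
  then show ?thesis
    by (simp add: sign_def)
qed

lemma list_mat_append:
  "list_mat A (xs @ ys) = four_block_mat (list_mat A xs)
     (mat (length xs) (length ys) (\<lambda>(r, c). A (xs ! r) (ys ! c)))
     (mat (length ys) (length xs) (\<lambda>(r, c). A (ys ! r) (xs ! c))) (list_mat A ys)"
  by (rule eq_matI) (auto simp: list_mat_def nth_append)

lemma det_list_mat_append_lower_zero:
  fixes A :: "'v \<Rightarrow> 'v \<Rightarrow> 'c :: idom"
  assumes "\<And>x y. x \<in> set xs \<Longrightarrow> y \<in> set ys \<Longrightarrow> A y x = 0"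
  shows "det (list_mat A (xs @ ys)) = det (list_mat A xs) * det (list_mat A ys)"
  unfolding list_mat_append
  by (rule det_four_block_mat_lower_left_zero) (use assms in auto)

lemma det_list_mat_append_upper_zero:
  fixes A :: "'v \<Rightarrow> 'v \<Rightarrow> 'c :: idom"
  assumes "\<And>x y. x \<in> set xs \<Longrightarrow> y \<in> set ys \<Longrightarrow> A x y = 0"
  shows "det (list_mat A (xs @ ys)) = det (list_mat A xs) * det (list_mat A ys)"
  unfolding list_mat_append
  by (rule det_four_block_mat_upper_right_zero) (use assms in auto)

text \<open>The matrix is block diagonal; peeling off the first block leaves a block triangular
  matrix at each stage of the induction.\<close>

lemma det_list_mat_concat:
  fixes A :: "'v \<Rightarrow> 'v \<Rightarrow> 'c :: idom"
  assumes "distinct is"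
    and "\<And>i j u v. i \<in> set is \<Longrightarrow> j \<in> set is \<Longrightarrow> i \<noteq> j \<Longrightarrow>
           u \<in> set (f i) \<Longrightarrow> v \<in> set (f j) \<Longrightarrow> A u v = 0"
  shows "det (list_mat A (concat (map f is))) = (\<Prod>i\<in>set is. det (list_mat A (f i)))"
  using assms
proof (induction "is")
  case Nil
  then show ?case by (simp add: list_mat_def det_dim_zero)
next
  case (Cons i "is")
  have "det (list_mat A (f i @ concat (map f is)))
      = det (list_mat A (f i)) * det (list_mat A (concat (map f is)))"
    by (rule det_list_mat_append_lower_zero) (use Cons.prems in auto)
  moreover have "det (list_mat A (concat (map f is))) = (\<Prod>i\<in>set is. det (list_mat A (f i)))"
    by (rule Cons.IH) (use Cons.prems in auto)
  ultimately show ?case using Cons.prems by simp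
qed

lemma list_mat_one: "distinct xs \<Longrightarrow> list_mat (\<lambda>u v. of_bool (u = v)) xs = 1\<^sub>m (length xs)"
  by (rule eq_matI) (auto simp: list_mat_def nth_eq_iff_index_eq)

section \<open>Block triangularization along an equitable partition\<close>

text \<open>
  \<open>xs\<close> lists one representative per block, \<open>ys\<close> the remaining indices, and \<open>r\<close> sends an index to
  its representative. In the basis of the block indicators and the unit vectors at \<open>ys\<close> (the
  columns of \<open>P\<close> in the proof), \<open>M\<close> is block triangular.
\<close>

lemma det_list_mat_quotient:
  fixes M :: "'v \<Rightarrow> 'v \<Rightarrow> 'c :: idom"
  defines "S \<equiv> \<lambda>xs ys r u x. \<Sum>v | v \<in> set (xs @ ys) \<and> r v = x. M u v"
  assumes dist: "distinct (xs @ ys)"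
    and r: "r ` set ys \<subseteq> set xs" "\<And>x. x \<in> set xs \<Longrightarrow> r x = x"
    and equitable: "\<And>w x. w \<in> set ys \<Longrightarrow> x \<in> set xs \<Longrightarrow> S xs ys r w x = S xs ys r (r w) x"
  shows "det (list_mat M (xs @ ys)) =
    det (list_mat (S xs ys r) xs) * det (list_mat (\<lambda>u v. M u v - M (r u) v) ys)"
proof -
  let ?zs = "xs @ ys"
  define P :: "'v \<Rightarrow> 'v \<Rightarrow> 'c"
    where "P = (\<lambda>w v. if v \<in> set xs then of_bool (r w = v) else of_bool (w = v))"
  define MP where "MP = (\<lambda>w v. if v \<in> set xs then S xs ys r w v else M w v)"
  \<comment> \<open>\<open>N\<close> is the matrix of \<open>M\<close> in the new basis: a
    non-representative row of \<open>MP\<close> has the row of its representative subtracted. The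
    inverse of \<open>P\<close> is avoided by showing that \<open>M\<close> times \<open>P\<close>
    and \<open>P\<close> times \<open>N\<close> are both \<open>MP\<close>.\<close>
  define N where "N = (\<lambda>w v. if w \<in> set xs then MP w v else MP w v - MP (r w) v)"
  have disj: "set xs \<inter> set ys = {}" using dist by auto
  \<comment> \<open>Both diagonal blocks of \<open>P\<close> are identities, since \<open>r\<close>
    fixes the representatives. The block indicators can be nonzero only below them.\<close>
  have detP: "det (list_mat P ?zs) = 1"
  proof -
    have "det (list_mat P ?zs) = det (list_mat P xs) * det (list_mat P ys)"
      by (rule det_list_mat_append_upper_zero) (use disj in \<open>auto simp: P_def\<close>)
    also have "list_mat P xs = list_mat (\<lambda>u v. of_bool (u = v)) xs"
      by (rule list_mat_cong) (use r in \<open>auto simp: P_def\<close>)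
    also have "list_mat P ys = list_mat (\<lambda>u v. of_bool (u = v)) ys"
      by (rule list_mat_cong) (use disj in \<open>auto simp: P_def\<close>)
    finally show ?thesis using dist by (simp add: list_mat_one)
  qed
  have "list_mat M ?zs * list_mat P ?zs = list_mat MP ?zs"
    unfolding list_mat_times[OF dist]
  proof (rule list_mat_cong[OF refl])
    fix u v assume u: "u \<in> set ?zs" and v: "v \<in> set ?zs"
    show "(\<Sum>w\<in>set ?zs. M u w * P w v) = MP u v"
    proof (cases "v \<in> set xs")
      case True
      have "(\<Sum>w\<in>set ?zs. M u w * P w v) = (\<Sum>w\<in>set ?zs. if r w = v then M u w else 0)"
        by (rule sum.cong) (use True in \<open>auto simp: P_def\<close>)
      also have "\<dots> = S xs ys r u v"
        by (simp only: S_def sum.inter_filter[OF finite_set])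
      finally show ?thesis using True by (simp add: MP_def)
    next
      case False
      have "(\<Sum>w\<in>set ?zs. M u w * P w v) = (\<Sum>w\<in>set ?zs. if w = v then M u w else 0)"
        by (rule sum.cong) (use False in \<open>auto simp: P_def\<close>)
      also have "\<dots> = M u v"
        using v by (simp add: sum.delta')
      finally show ?thesis using False by (simp add: MP_def)
    qed
  qed
  moreover have "list_mat P ?zs * list_mat N ?zs = list_mat MP ?zs"
    unfolding list_mat_times[OF dist]
  proof (rule list_mat_cong[OF refl])
    fix u v assume u: "u \<in> set ?zs" and v: "v \<in> set ?zs"
    have "(\<Sum>w\<in>set ?zs. P u w * N w v) = (\<Sum>w\<in>set xs. P u w * N w v) + (\<Sum>w\<in>set ys. P u w * N w v)"
      using disj by (simp add: sum.union_disjoint)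
    also have "(\<Sum>w\<in>set xs. P u w * N w v) = (\<Sum>w\<in>set xs. if r u = w then N w v else 0)"
      by (rule sum.cong) (auto simp: P_def)
    also have "\<dots> = N (r u) v"
      using u r by (auto simp: sum.delta)
    also have "(\<Sum>w\<in>set ys. P u w * N w v) = (\<Sum>w\<in>set ys. if u = w then N w v else 0)"
      by (rule sum.cong) (use disj in \<open>auto simp: P_def\<close>)
    also have "\<dots> = (if u \<in> set ys then N u v else 0)"
      by (simp add: sum.delta)
    \<comment> \<open>For \<open>u\<close> in \<open>ys\<close>, adding the representative's row
      undoes the subtraction in \<open>N\<close>; for \<open>u\<close> in \<open>xs\<close>,
      \<open>r u = u\<close> and the second summand is 0.\<close>
    also have "N (r u) v + \<dots> = MP u v"
      using u r disj by (auto simp: N_def)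
    finally show "(\<Sum>w\<in>set ?zs. P u w * N w v) = MP u v" .
  qed
  ultimately have "det (list_mat M ?zs * list_mat P ?zs) = det (list_mat P ?zs * list_mat N ?zs)"
    by simp
  then have "det (list_mat M ?zs) = det (list_mat N ?zs)"
    using detP by (simp only: det_mult[OF list_mat_carrier list_mat_carrier] mult_1_left mult_1_right)
  \<comment> \<open>Equitability says exactly that the lower left block of \<open>N\<close> is
    zero.\<close>
  also have "\<dots> = det (list_mat N xs) * det (list_mat N ys)"
    by (rule det_list_mat_append_lower_zero) (use disj equitable in \<open>auto simp: N_def MP_def\<close>)
  also have "list_mat N xs = list_mat (S xs ys r) xs"
    by (rule list_mat_cong) (auto simp: N_def MP_def)
  also have "list_mat N ys = list_mat (\<lambda>u v. M u v - M (r u) v) ys"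
    by (rule list_mat_cong) (use disj in \<open>auto simp: N_def MP_def\<close>)
  finally show ?thesis .
qed

section \<open>Characteristic polynomials of list-indexed matrices\<close>

lemma char_poly_list_mat:
  fixes A :: "'v \<Rightarrow> 'v \<Rightarrow> 'c :: comm_ring_1"
  assumes "distinct xs"
  shows "char_poly (list_mat A xs) =
    det (list_mat (\<lambda>u v. of_bool (u = v) * [:0, 1:] - [:A u v:]) xs)"
  unfolding char_poly_defs
  by (rule arg_cong[where f = det], rule eq_matI)
     (use assms in \<open>auto simp: list_mat_def nth_eq_iff_index_eq\<close>)

lemma poly_char_poly_list_mat:
  fixes A :: "'v \<Rightarrow> 'v \<Rightarrow> 'c :: field"
  assumes "distinct xs"
  shows "poly (char_poly (list_mat A xs)) z =
    det (list_mat (\<lambda>u v. of_bool (u = v) * z - A u v) xs)"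
  unfolding char_poly_matrix[OF list_mat_carrier] char_matrix_def
  by (rule arg_cong[where f = det], rule eq_matI)
     (use assms in \<open>auto simp: list_mat_def nth_eq_iff_index_eq\<close>)

text \<open>Adding \<open>d\<close> times the identity can be absorbed into the scalar: both sides
  are the determinant of (z - d)I - A.\<close>

lemma poly_char_poly_list_mat_shift:
  fixes A :: "'v \<Rightarrow> 'v \<Rightarrow> 'c :: field"
  assumes "distinct xs"
  shows "poly (char_poly (list_mat (\<lambda>u v. A u v + of_bool (u = v) * d) xs)) z =
    poly (char_poly (list_mat A xs)) (z - d)"
  unfolding poly_char_poly_list_mat[OF assms]
  by (rule arg_cong[where f = det], rule list_mat_cong) (auto simp: algebra_simps)

lemma char_poly_list_mat_mset_cong:
  fixes A :: "'v \<Rightarrow> 'v \<Rightarrow> 'c :: comm_ring_1"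
  assumes "distinct xs" "mset xs = mset ys"
  shows "char_poly (list_mat A xs) = char_poly (list_mat A ys)"
proof -
  have "distinct ys" using assms by (metis mset_eq_imp_distinct_iff)
  with assms show ?thesis
    by (simp add: char_poly_list_mat det_list_mat_mset_cong[OF assms(2)])
qed

lemma char_poly_list_mat_concat:
  fixes A :: "'v \<Rightarrow> 'v \<Rightarrow> 'c :: idom"
  assumes "distinct is" "distinct (concat (map f is))"
    and disj: "\<And>i j. i \<in> set is \<Longrightarrow> j \<in> set is \<Longrightarrow> i \<noteq> j \<Longrightarrow> set (f i) \<inter> set (f j) = {}"
    and zero: "\<And>i j u v. i \<in> set is \<Longrightarrow> j \<in> set is \<Longrightarrow> i \<noteq> j \<Longrightarrow>
           u \<in> set (f i) \<Longrightarrow> v \<in> set (f j) \<Longrightarrow> A u v = 0"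
  shows "char_poly (list_mat A (concat (map f is))) = (\<Prod>i\<in>set is. char_poly (list_mat A (f i)))"
proof -
  have f: "distinct (f i)" if "i \<in> set is" for i
    using assms(2) that by (auto simp: distinct_concat_iff)
  show ?thesis
    unfolding char_poly_list_mat[OF assms(2)]
  proof (subst det_list_mat_concat)
    fix i j u v assume *: "i \<in> set is" "j \<in> set is" "i \<noteq> j" "u \<in> set (f i)" "v \<in> set (f j)"
    \<comment> \<open>Disjoint blocks keep the indeterminate out of the off-diagonal blocks.\<close>
    then have "u \<noteq> v" using disj by blast
    with * show "of_bool (u = v) * [:0, 1:] - [:A u v:] = 0" using zero by simp
  qed (use assms(1) f in \<open>auto simp: char_poly_list_mat intro!: prod.cong\<close>)
qed

lemma const_poly_sum: "[:sum f A:] = (\<Sum>x\<in>A. [:f x:])"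
proof (induction A rule: infinite_finite_induct)
  case (insert x F)
  have "[:f x + sum f F:] = [:f x:] + [:sum f F:]" by simp
  then show ?case using insert by (simp only: sum.insert not_False_eq_True)
qed simp_all

text \<open>This is \<open>det_list_mat_quotient\<close> applied to xI - A, whose entries lie in a
  polynomial ring; hence the determinant version works over integral domains rather than
  fields.\<close>

lemma char_poly_list_mat_quotient:
  fixes A :: "'v \<Rightarrow> 'v \<Rightarrow> 'c :: idom"
  defines "S \<equiv> \<lambda>xs ys r u x. \<Sum>v | v \<in> set (xs @ ys) \<and> r v = x. A u v"
  assumes dist: "distinct (xs @ ys)"
    and r: "r ` set ys \<subseteq> set xs" "\<And>x. x \<in> set xs \<Longrightarrow> r x = x"
    and equitable: "\<And>w x. w \<in> set ys \<Longrightarrow> x \<in> set xs \<Longrightarrow> S xs ys r w x = S xs ys r (r w) x"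
  shows "char_poly (list_mat A (xs @ ys)) =
    char_poly (list_mat (S xs ys r) xs) * char_poly (list_mat (\<lambda>u v. A u v - A (r u) v) ys)"
proof -
  let ?M = "\<lambda>u v. of_bool (u = v) * [:0, 1:] - [:A u v:]"
  \<comment> \<open>The row of xI at \<open>u\<close> has its only nonzero entry in the block of
    \<open>u\<close>, so xI is itself equitable and contributes xI to the quotient.\<close>
  have sum_M: "(\<Sum>v | v \<in> set (xs @ ys) \<and> r v = x. ?M u v)
      = of_bool (r u = x) * [:0, 1:] - [:S xs ys r u x:]" if "u \<in> set (xs @ ys)" for u x
  proof -
    let ?F = "{v \<in> set (xs @ ys). r v = x}"
    have "(\<Sum>v\<in>?F. of_bool (u = v) * [:0, 1:]) = (\<Sum>v\<in>?F. if u = v then [:0, 1:] else 0 :: 'c poly)"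
      by (rule sum.cong) auto
    also have "\<dots> = of_bool (r u = x) * [:0, 1:]"
      using that by (subst sum.delta') auto
    finally show ?thesis
      by (simp only: sum_subtractf S_def const_poly_sum)
  qed
  have "char_poly (list_mat A (xs @ ys)) =
    det (list_mat (\<lambda>u x. \<Sum>v | v \<in> set (xs @ ys) \<and> r v = x. ?M u v) xs) *
    det (list_mat (\<lambda>u v. ?M u v - ?M (r u) v) ys)"
    unfolding char_poly_list_mat[OF dist]
  proof (rule det_list_mat_quotient[OF dist r])
    fix w x assume "w \<in> set ys" "x \<in> set xs"
    then show "(\<Sum>v | v \<in> set (xs @ ys) \<and> r v = x. ?M w v)
        = (\<Sum>v | v \<in> set (xs @ ys) \<and> r v = x. ?M (r w) v)"
      using r equitable[of w x] by (subst (1 2) sum_M) auto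
  qed
  also have "list_mat (\<lambda>u x. \<Sum>v | v \<in> set (xs @ ys) \<and> r v = x. ?M u v) xs =
      list_mat (\<lambda>u x. of_bool (u = x) * [:0, 1:] - [:S xs ys r u x:]) xs"
    by (rule list_mat_cong[OF refl], subst sum_M) (use r in auto)
  \<comment> \<open>The column \<open>v\<close> is in \<open>ys\<close> while \<open>r u\<close> is
    in \<open>xs\<close>, so the subtracted row carries no indeterminate.\<close>
  also have "list_mat (\<lambda>u v. ?M u v - ?M (r u) v) ys =
      list_mat (\<lambda>u v. of_bool (u = v) * [:0, 1:] - [:A u v - A (r u) v:]) ys"
    by (rule list_mat_cong) (use dist r in auto)
  finally show ?thesis
    using dist by (simp add: char_poly_list_mat)
qed

text \<open>Over the complex numbers the polynomial splits into monic linear factors, so its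
  multiset of roots determines it. This turns the numbering of eigenvalues by \<open>K\<close> into
  a product over \<open>K\<close>.\<close>

lemma char_poly_eq_prod_eigenvalues:
  assumes "A \<in> carrier_mat N N" "finite K"
    and "image_mset \<mu> (mset_set K) = eigenvalue_mset A"
  shows "char_poly A = (\<Prod>k\<in>K. [:- \<mu> k, 1:])"
proof -
  obtain as where as: "char_poly A = (\<Prod>a\<leftarrow>as. [:- a, 1:])"
    using char_poly_factorized[OF assms(1)] by blast
  \<comment> \<open>Multiplicativity of \<open>proots\<close> requires nonzero factors; the claim is
    made for all lists so that it covers the tails in the next induction.\<close>
  have "(\<Prod>a\<leftarrow>as. [:- a, 1:]) \<noteq> 0" for as :: "complex list"
    by (auto simp: prod_list_zero_iff)
  then have "proots (\<Prod>a\<leftarrow>as. [:- a, 1:]) = mset as"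
    by (induction as) (simp_all add: proots_mult del: mult_pCons_left)
  then have "mset as = image_mset \<mu> (mset_set K)"
    using assms(3) as by (simp add: eigenvalue_mset_def)
  then have "prod_mset (image_mset (\<lambda>a. [:- a, 1:]) (mset as)) = (\<Prod>k\<in>K. [:- \<mu> k, 1:])"
    using assms(2) by (simp add: image_mset.compositionality comp_def prod_unfold_prod_mset)
  then show ?thesis
    using as by (metis mset_map prod_mset_prod_list)
qed

section \<open>The Laplacian of a single digraph\<close>

lemma out_degree_eq_card_succ:
  "out_degree (with_proj H) u = card {v. (u, v) \<in> parcs H}"
proof -
  have "out_arcs (with_proj H) u = Pair u ` {v. (u, v) \<in> parcs H}"
    by (auto simp: out_arcs_def)
  then show ?thesis
    by (simp add: out_degree_def card_image inj_on_def)
qed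

lemma sum_laplacian_entry:
  assumes "pair_digraph H" "u \<in> pverts H"
  shows "(\<Sum>v\<in>pverts H. laplacian_entry H u v) = 0"
proof -
  interpret pair_digraph H by fact
  \<comment> \<open>Without loops, excluding \<open>u\<close> discards no out-neighbour, so the
    off-diagonal entries add up to minus the outdegree.\<close>
  have succ: "{v \<in> pverts H - {u}. (u, v) \<in> parcs H} = {v. (u, v) \<in> parcs H}"
    using pair_no_loops in_arcsD2 by fastforce
  have "(\<Sum>v\<in>pverts H - {u}. laplacian_entry H u v)
      = (\<Sum>v\<in>pverts H - {u}. if (u, v) \<in> parcs H then - 1 else 0)"
    by (rule sum.cong) (auto simp: laplacian_entry_def)
  also have "\<dots> = (\<Sum>v | v \<in> pverts H - {u} \<and> (u, v) \<in> parcs H. - 1)"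
    using pair_finite_verts by (subst sum.inter_filter) auto
  also have "\<dots> = - of_nat (out_degree (with_proj H) u)"
    using succ by (simp add: out_degree_eq_card_succ)
  finally show ?thesis
    using assms(2) pair_finite_verts by (simp add: sum.remove[of _ u] laplacian_entry_def)
qed

text \<open>All vertices form one block represented by \<open>h\<close>; as the row sums vanish, the
  quotient is the 1 by 1 zero matrix, which accounts for one eigenvalue 0. The other factor carries
  the remaining eigenvalues.\<close>

lemma char_poly_laplacian_Cons:
  assumes "pair_digraph H" "vertex_listing H (h # ws)"
  shows "char_poly (laplacian_mat H (h # ws)) = [:0, 1:] *
    char_poly (list_mat (\<lambda>u v. laplacian_entry H u v - laplacian_entry H h v) ws)"
proof -
  let ?L = "laplacian_entry H"
  have d: "distinct ([h] @ ws)" and V: "pverts H = set ([h] @ ws)"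
    using assms(2) by (auto simp: vertex_listing_def)
  have row: "(\<Sum>v | v \<in> set ([h] @ ws) \<and> h = x. ?L u v) = 0" if "u \<in> set ([h] @ ws)" "x = h" for u x
    using sum_laplacian_entry[OF assms(1), of u] that unfolding V by (simp only: simp_thms Collect_mem_eq)
  have "char_poly (list_mat ?L ([h] @ ws)) =
      char_poly (list_mat (\<lambda>u x. \<Sum>v | v \<in> set ([h] @ ws) \<and> h = x. ?L u v) [h]) *
      char_poly (list_mat (\<lambda>u v. ?L u v - ?L h v) ws)"
  proof (rule char_poly_list_mat_quotient[OF d, where r = "\<lambda>_. h"])
    fix w x assume "w \<in> set ws" "x \<in> set [h]"
    then show "(\<Sum>v | v \<in> set ([h] @ ws) \<and> h = x. ?L w v) = (\<Sum>v | v \<in> set ([h] @ ws) \<and> h = x. ?L h v)"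
      using row[of w x] row[of h x] by simp
  qed auto
  also have "list_mat (\<lambda>u x. \<Sum>v | v \<in> set ([h] @ ws) \<and> h = x. ?L u v) [h] = list_mat (\<lambda>u v. 0) [h]"
    by (rule list_mat_cong) (use row in auto)
  also have "char_poly (list_mat (\<lambda>u v. 0) [h]) = [:0, 1 :: complex:]"
    by (simp add: char_poly_list_mat) (simp add: list_mat_def det_single)
  finally show ?thesis by (simp add: laplacian_mat_eq_list_mat)
qed

section \<open>The Laplacian of the generalized join\<close>

lemma out_degree_gen_join:
  assumes "pair_digraph G" "\<forall>i\<in>pverts G. pair_digraph (H i)"
    and "i \<in> pverts G" "u \<in> pverts (H i)"
  shows "out_degree (with_proj (gen_join G H)) (i, u) =
    out_degree (with_proj (H i)) u + (\<Sum>j | (i, j) \<in> parcs G. card (pverts (H j)))"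
proof -
  interpret G: pair_digraph G by fact
  interpret Hi: pair_digraph "H i" using assms by blast
  let ?J = "{j. (i, j) \<in> parcs G}"
  have J: "?J \<subseteq> pverts G" using G.in_arcsD2 by auto
  then have fin: "finite ?J" using G.pair_finite_verts finite_subset by blast
  have fin': "finite (pverts (H j))" if "j \<in> ?J" for j
    using assms(2) J that by (meson pair_digraph.axioms(1) pair_fin_digraph.pair_finite_verts subsetD)
  have loop: "i \<notin> ?J" using G.pair_no_loops by fastforce
  \<comment> \<open>Out-neighbours lie either in the same copy or anywhere in a copy that
    \<open>i\<close> points to; the two sets are disjoint because \<open>G\<close> has no loop at
    \<open>i\<close>.\<close>
  have succ: "{w. ((i, u), w) \<in> parcs (gen_join G H)}
      = Pair i ` {v. (u, v) \<in> parcs (H i)} \<union> Sigma ?J (\<lambda>j. pverts (H j))"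
    using assms(3,4) J loop Hi.in_arcsD2 by (auto simp: gen_join_def split: if_splits)
  have "finite {v. (u, v) \<in> parcs (H i)}"
    by (rule finite_subset[OF _ Hi.pair_finite_verts]) (use Hi.in_arcsD2 in auto)
  then show ?thesis
    unfolding out_degree_eq_card_succ succ using loop fin fin'
    by (subst card_Un_disjoint) (auto simp: card_image inj_on_def card_SigmaI)
qed

text \<open>The constancy of the off-diagonal blocks makes the partition equitable and makes these
  blocks cancel on subtracting a representative's row.\<close>

lemma laplacian_entry_gen_join:
  assumes "pair_digraph G" "\<forall>i\<in>pverts G. pair_digraph (H i)"
    and "i \<in> pverts G" "u \<in> pverts (H i)" "j \<in> pverts G" "v \<in> pverts (H j)"
  shows "laplacian_entry (gen_join G H) (i, u) (j, v) =
    (if i = j then laplacian_entry (H i) u v +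
       of_bool (u = v) * of_nat (\<Sum>k | (i, k) \<in> parcs G. card (pverts (H k)))
     else - of_bool ((i, j) \<in> parcs G))"
proof -
  have "((i, u), (j, v)) \<in> parcs (gen_join G H) \<longleftrightarrow>
      (if i = j then (u, v) \<in> parcs (H i) else (i, j) \<in> parcs G)"
    using assms(3-) by (auto simp: gen_join_def)
  then show ?thesis
    using out_degree_gen_join[OF assms(1-4)] by (auto simp: laplacian_entry_def)
qed

text \<open>Evaluation at \<open>z\<close> lets the shift of each diagonal block by
  \<open>d i\<close> appear as the argument \<open>z - d i\<close>. The factors are still reduced
  matrices, with \<open>h i\<close> representing block \<open>i\<close>; eigenvalues enter only in
  the theorem.\<close>

lemma char_poly_laplacian_gen_join:
  fixes G :: "'i pair_pre_digraph" and H :: "'i \<Rightarrow> 'a pair_pre_digraph" and h :: "'i \<Rightarrow> 'a"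
  defines "d \<equiv> \<lambda>i. of_nat (\<Sum>k | (i, k) \<in> parcs G. card (pverts (H k))) :: complex"
  assumes G: "pair_digraph G" and H: "\<forall>i\<in>pverts G. pair_digraph (H i)"
    and "is": "vertex_listing G is"
    and ws: "\<And>i. i \<in> pverts G \<Longrightarrow> vertex_listing (H i) (h i # ws i)"
    and vs: "vertex_listing (gen_join G H) vs"
  shows "poly (char_poly (laplacian_mat (gen_join G H) vs)) z =
    poly (char_poly (list_mat (\<lambda>i j. if i = j then d i
      else - of_nat (join_arc_weight G (\<lambda>k. card (pverts (H k))) i j)) is)) z *
    (\<Prod>i\<in>pverts G. poly (char_poly (list_mat
      (\<lambda>u v. laplacian_entry (H i) u v - laplacian_entry (H i) (h i) v) (ws i))) (z - d i))"
proof -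
  let ?L = "laplacian_entry (gen_join G H)"
  define xs where "xs = map (\<lambda>i. (i, h i)) is"
  define f where "f = (\<lambda>i. map (Pair i) (ws i))"
  define ys where "ys = concat (map f is)"
  define r where "r = (\<lambda>(i, u :: 'a). (i, h i))"
  have dis: "distinct is" and set_is: "set is = pverts G"
    using "is" by (auto simp: vertex_listing_def)
  have VH: "pverts (H i) = insert (h i) (set (ws i))" and
    dws: "distinct (ws i)" "h i \<notin> set (ws i)" if "i \<in> pverts G" for i
    using ws[OF that] by (auto simp: vertex_listing_def)
  have setxs: "set xs = (\<lambda>i. (i, h i)) ` pverts G"
    by (simp add: xs_def set_is)
  have setys: "set ys = Sigma (pverts G) (\<lambda>i. set (ws i))"
    by (auto simp: ys_def f_def set_is)
  have "set (xs @ ys) = Sigma (pverts G) (\<lambda>i. pverts (H i))"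
    using VH by (auto simp: setxs setys)
  then have V: "set (xs @ ys) = pverts (gen_join G H)"
    by (simp add: gen_join_def)
  have dxs: "distinct xs"
    using dis by (auto simp: xs_def distinct_map inj_on_def)
  \<comment> \<open>Generalized to lists within \<open>pverts G\<close>, because distinctness of
    \<open>ws i\<close> is known only for such \<open>i\<close>.\<close>
  have "distinct (concat (map f js))" if "distinct js" "set js \<subseteq> pverts G" for js
    using that by (induction js) (auto simp: f_def distinct_map inj_on_def dws)
  then have dys: "distinct ys" by (simp add: ys_def dis set_is)
  have d: "distinct (xs @ ys)"
    using dxs dys dws by (auto simp: setxs setys)
  have msetvs: "mset vs = mset (xs @ ys)"
    using vs d V by (metis set_eq_iff_mset_eq_distinct vertex_listing_def)
  define Q :: "'i \<Rightarrow> 'i \<Rightarrow> complex" where "Q = (\<lambda>i j. if i = j then d i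
      else - of_nat (join_arc_weight G (\<lambda>k. card (pverts (H k))) i j))"
  \<comment> \<open>The block sum does not depend on \<open>u\<close>, which is the equitability
    required below. On the diagonal the row sum of \<open>H i\<close> vanishes and leaves
    \<open>d i\<close>; elsewhere a constant is summed over block \<open>j\<close>.\<close>
  have Q: "(\<Sum>v | v \<in> set (xs @ ys) \<and> r v = (j, h j). ?L (i, u) v) = Q i j"
    if i: "i \<in> pverts G" and u: "u \<in> pverts (H i)" and j: "j \<in> pverts G" for i j u
  proof -
    have "{v \<in> set (xs @ ys). r v = (j, h j)} = Pair j ` pverts (H j)"
      using j unfolding V by (auto simp: r_def gen_join_def)
    then have "(\<Sum>v | v \<in> set (xs @ ys) \<and> r v = (j, h j). ?L (i, u) v)
        = (\<Sum>v\<in>pverts (H j). ?L (i, u) (j, v))"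
      by (simp add: sum.reindex inj_on_def)
    also have "\<dots> = (\<Sum>v\<in>pverts (H j). if i = j then laplacian_entry (H i) u v + (if u = v then d i else 0)
        else - of_bool ((i, j) \<in> parcs G))"
      by (rule sum.cong) (use laplacian_entry_gen_join[OF G H i u j] in \<open>auto simp: d_def\<close>)
    also have "\<dots> = Q i j"
    proof (cases "i = j")
      case True
      have "finite (pverts (H i))" using VH i by simp
      with True show ?thesis
        using sum_laplacian_entry[OF bspec[OF H i] u] u by (simp add: Q_def sum.distrib)
    qed (simp add: Q_def join_arc_weight_def)
    finally show ?thesis .
  qed
  have "char_poly (laplacian_mat (gen_join G H) vs) = char_poly (list_mat ?L (xs @ ys))"
    unfolding laplacian_mat_eq_list_mat
    by (rule char_poly_list_mat_mset_cong[OF _ msetvs]) (use vs in \<open>simp add: vertex_listing_def\<close>)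
  also have "\<dots> = char_poly (list_mat (\<lambda>u x. \<Sum>v | v \<in> set (xs @ ys) \<and> r v = x. ?L u v) xs) *
      char_poly (list_mat (\<lambda>u v. ?L u v - ?L (r u) v) ys)"
  proof (rule char_poly_list_mat_quotient[OF d])
    show "r ` set ys \<subseteq> set xs" by (auto simp: setxs setys r_def)
    show "r x = x" if "x \<in> set xs" for x using that by (auto simp: setxs r_def)
    fix w x assume "w \<in> set ys" "x \<in> set xs"
    then obtain i u j where *: "w = (i, u)" "x = (j, h j)" "i \<in> pverts G" "u \<in> set (ws i)" "j \<in> pverts G"
      by (auto simp: setxs setys)
    then show "(\<Sum>v | v \<in> set (xs @ ys) \<and> r v = x. ?L w v)
        = (\<Sum>v | v \<in> set (xs @ ys) \<and> r v = x. ?L (r w) v)"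
      using Q[of i u j] Q[of i "h i" j] VH[of i] by (simp add: r_def)
  qed
  also have "list_mat (\<lambda>u x. \<Sum>v | v \<in> set (xs @ ys) \<and> r v = x. ?L u v) xs = list_mat Q is"
    \<comment> \<open>\<open>xs\<close> is unfolded only as the index list; inside the sums it stays
      folded so that \<open>Q\<close> applies.\<close>
    unfolding xs_def[THEN arg_cong[where f = "list_mat _"]] list_mat_map
    by (rule list_mat_cong[OF refl]) (use Q VH set_is in auto)
  also have "char_poly (list_mat (\<lambda>u v. ?L u v - ?L (r u) v) ys) =
      (\<Prod>i\<in>set is. char_poly (list_mat (\<lambda>u v. ?L u v - ?L (r u) v) (f i)))"
    unfolding ys_def
  proof (rule char_poly_list_mat_concat[OF dis])
    show "distinct (concat (map f is))" using dys by (simp add: ys_def)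
    show "set (f i) \<inter> set (f j) = {}" if "i \<noteq> j" for i j using that by (auto simp: f_def)
    fix i j u v
    assume "i \<in> set is" "j \<in> set is" "i \<noteq> j" "u \<in> set (f i)" "v \<in> set (f j)"
    \<comment> \<open>\<open>u\<close> and \<open>r u\<close> lie in the same copy, so they have
      equal entries towards a different copy.\<close>
    then show "?L u v - ?L (r u) v = 0"
      by (auto simp: f_def r_def set_is VH laplacian_entry_gen_join[OF G H])
  qed
  finally have *: "char_poly (laplacian_mat (gen_join G H) vs) = char_poly (list_mat Q is) *
    (\<Prod>i\<in>pverts G. char_poly (list_mat (\<lambda>u v. ?L u v - ?L (r u) v) (f i)))"
    by (simp add: set_is)
  have "poly (char_poly (list_mat (\<lambda>u v. ?L u v - ?L (r u) v) (f i))) z =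
      poly (char_poly (list_mat
        (\<lambda>u v. laplacian_entry (H i) u v - laplacian_entry (H i) (h i) v) (ws i))) (z - d i)"
    if i: "i \<in> pverts G" for i
  proof -
    \<comment> \<open>Since \<open>h i\<close> is not in \<open>ws i\<close>, the representative's
      row contributes no diagonal shift, and the term in \<open>d i\<close> survives the
      subtraction.\<close>
    have "list_mat (\<lambda>u v. ?L u v - ?L (r u) v) (f i) =
      list_mat (\<lambda>u v. (laplacian_entry (H i) u v - laplacian_entry (H i) (h i) v) + of_bool (u = v) * d i) (ws i)"
      unfolding f_def list_mat_map
      by (rule list_mat_cong[OF refl])
         (use dws[OF i] i in \<open>auto simp: r_def VH d_def laplacian_entry_gen_join[OF G H]\<close>)
    then show ?thesis
      using poly_char_poly_list_mat_shift[OF dws(1)[OF i]] by simp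
  qed
  then show ?thesis
    unfolding * by (simp add: poly_prod Q_def)
qed

text \<open>As \<open>z\<close> is an arbitrary complex number, equality of values amounts to the
  identity of polynomials.\<close>

theorem lemma3p4:
  fixes n :: nat
    and G :: "nat pair_pre_digraph"
    and H :: "nat \<Rightarrow> 'a pair_pre_digraph"
    and m :: "nat \<Rightarrow> nat"
    and vs :: "(nat \<times> 'a) list"
    and ws :: "nat \<Rightarrow> 'a list"
    and \<mu> :: "nat \<Rightarrow> nat \<Rightarrow> complex"
    and z :: complex
  assumes "n \<ge> 1"
    and "pair_digraph G"
    and "pverts G = {1..n}"
    and "\<And>i. i \<in> {1..n} \<Longrightarrow> pair_digraph (H i)"
    and "\<And>i. i \<in> {1..n} \<Longrightarrow> pverts (H i) \<noteq> {}"
    and "\<And>i. i \<in> {1..n} \<Longrightarrow> m i = card (pverts (H i))"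
    and "vertex_listing (gen_join G H) vs"
    and "\<And>i. i \<in> {1..n} \<Longrightarrow> vertex_listing (H i) (ws i)"
    and "\<And>i. i \<in> {1..n} \<Longrightarrow>
           image_mset (\<mu> i) (mset_set {1..m i}) = eigenvalue_mset (laplacian_mat (H i) (ws i))"
    and "\<And>i. i \<in> {1..n} \<Longrightarrow> \<mu> i (m i) = 0"
  shows "poly (char_poly (laplacian_mat (gen_join G H) vs)) z =
         poly (char_poly (join_B_mat n G m)) z *
         (\<Prod>i = 1..n. \<Prod>k = 1..m i - 1.
            z - \<mu> i k - of_nat (\<Sum>j | (i, j) \<in> parcs G. m j))"
proof -
  let ?L = "\<lambda>i. laplacian_entry (H i)"
  let ?is = "[1..<Suc n]"
  let ?d = "\<lambda>i. of_nat (\<Sum>j | (i, j) \<in> parcs G. card (pverts (H j))) :: complex"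
  interpret pair_digraph G by fact
  have arc: "j \<in> {1..n}" if "(i, j) \<in> parcs G" for i j
    using in_arcsD2[OF that] assms(3) by simp
  have d: "?d i = of_nat (\<Sum>j | (i, j) \<in> parcs G. m j)" for i
    by (rule arg_cong[where f = of_nat], rule sum.cong) (use arc assms(6) in auto)
  have is_list: "vertex_listing G ?is"
    by (auto simp: vertex_listing_def assms(3))
  have ws: "ws i = hd (ws i) # tl (ws i)" if "i \<in> {1..n}" for i
    using assms(5,8)[OF that] by (cases "ws i") (auto simp: vertex_listing_def)
  have reduced: "char_poly (list_mat (\<lambda>u v. ?L i u v - ?L i (hd (ws i)) v) (tl (ws i))) =
      (\<Prod>k = 1..m i - 1. [:- \<mu> i k, 1:])" (is "?C = ?R") if i: "i \<in> {1..n}" for i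
  proof -
    have "finite (pverts (H i))"
      using assms(8)[OF i] by (metis List.finite_set vertex_listing_def)
    then have m: "m i \<ge> 1"
      using assms(5,6)[OF i] by (simp add: Suc_le_eq card_gt_0_iff)
    \<comment> \<open>Nonemptiness of \<open>H i\<close> makes \<open>m i\<close> an index. It is
      split off because its eigenvalue is 0, matching the factor from the one-block
      quotient.\<close>
    then have "{1..m i} = insert (m i) {1..m i - 1}" by auto
    moreover have "m i \<notin> {1..m i - 1}" using m by auto
    ultimately have "(\<Prod>k = 1..m i. [:- \<mu> i k, 1:]) = [:0, 1:] * ?R"
      using assms(10)[OF i] by simp
    moreover have "char_poly (laplacian_mat (H i) (ws i)) = (\<Prod>k = 1..m i. [:- \<mu> i k, 1:])"
      by (rule char_poly_eq_prod_eigenvalues[of _ "length (ws i)"])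
         (use assms(9)[OF i] in \<open>auto simp: laplacian_mat_eq_list_mat\<close>)
    moreover have "char_poly (laplacian_mat (H i) (ws i)) = [:0, 1:] * ?C"
      using char_poly_laplacian_Cons[OF assms(4)[OF i], of "hd (ws i)" "tl (ws i)"]
        ws[OF i] assms(8)[OF i] by simp
    \<comment> \<open>The factor is cancelled as a polynomial, since its value may vanish.\<close>
    ultimately have "[:0, 1:] * ?C = [:0, 1:] * ?R" by simp
    then show ?thesis by (subst (asm) mult_cancel_left) simp
  qed
  \<comment> \<open>Position \<open>r\<close> of \<open>?is\<close> holds the vertex
    \<open>r + 1\<close>, which is the offset built into \<open>join_B_mat\<close>.\<close>
  have B: "list_mat (\<lambda>i j. if i = j then ?d i
      else - of_nat (join_arc_weight G (\<lambda>k. card (pverts (H k))) i j)) ?is = join_B_mat n G m"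
    by (rule eq_matI)
       (auto simp: list_mat_def join_B_mat_def d join_arc_weight_def assms(6) simp del: upt_Suc of_nat_sum)
  have "poly (char_poly (laplacian_mat (gen_join G H) vs)) z =
    poly (char_poly (join_B_mat n G m)) z *
    (\<Prod>i\<in>pverts G. poly (char_poly (list_mat
      (\<lambda>u v. ?L i u v - ?L i (hd (ws i)) v) (tl (ws i)))) (z - ?d i))"
    unfolding B[symmetric]
    by (rule char_poly_laplacian_gen_join[OF assms(2) _ is_list _ assms(7)])
       (use assms(3,4,8) ws in auto)
  also have "(\<Prod>i\<in>pverts G. poly (char_poly (list_mat
      (\<lambda>u v. ?L i u v - ?L i (hd (ws i)) v) (tl (ws i)))) (z - ?d i)) =
    (\<Prod>i = 1..n. \<Prod>k = 1..m i - 1. z - \<mu> i k - of_nat (\<Sum>j | (i, j) \<in> parcs G. m j))"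
    unfolding assms(3) d
    by (rule prod.cong[OF refl]) (simp add: reduced poly_prod algebra_simps)
  finally show ?thesis .
qed

end
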